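(* Let $\Gamma$ be a finite connected graph and let $A$ be a finite connected subgraph of $G=\mathbb{Z}\times\Gamma$. Fix $\delta>0$ and let $S=(S_n)_{n\ge0}$ be the random walk on the electrical network $G$ with conductances $c(e):=1+\delta\mathbf{1}_{\{e\in A\}}$. Fix a vertex $a\in A$ and suppose that there exist $d$ integers $s_1,\dots,s_d$ and an integer $r$ such that 1. $\bar a<s_1<\dots<s_d<r$; 2. for each $i\in\{1,\dots,d\}$, there exists $x\in\partial_vA$ with $\bar x=s_i$. Let $\sigma:=\inf\{n\ge1:(S_{n-1},S_n)\in\partial_eA\}$ be the first time the walk exits $A$, and let $H_r:=\min\{n\ge0:\bar S_n=r\}$. Then $$\mathbb{P}_a(H_r<\sigma)\ \le\ 5\exp\left(-\frac{1}{4^4|\Gamma|^3}\left(\frac{d^2}{1+\delta}\right)^{1/3}\right).$$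
   Context: Graphs are nonempty, locally finite and undirected; $|\Gamma|$ is the number of vertices of $\Gamma$. $\mathbb{Z}\times\Gamma$ is the Cartesian product graph: $(i,\gamma)\sim(j,\gamma')$ iff ($i=j$ and $\gamma\sim\gamma'$ in $\Gamma$) or ($\gamma=\gamma'$ and $|i-j|=1$). For a vertex $a=(i,\gamma)$, $\bar a:=i$ is its level. The random walk on a network with edge conductances $c$ is the Markov chain which moves from its current vertex to a neighbor chosen with probability proportional to the conductance of the edge traversed; $\mathbb{P}_a$ is its law started from $a$. For a subgraph $A=(V_A,E_A)$ of $G$: $\partial_eA$ is the set of directed edges $(x,y)$ of $G$ with $x\in V_A$ and $\{x,y\}\notin E_A$ ($y$ may or may not be in $V_A$); $\partial_vA$ is the set of vertices $x\in V_A$ for which there is some $(x,y)\in\partial_eA$. *)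

theory Defs
  imports "HOL-Probability.Probability" "Graph_Theory.Graph_Theory"
begin

text \<open>
  Undirected graphs are symmetric pair digraphs: the edge \<open>{x, y}\<close> is the pair of
  arcs \<open>(x, y)\<close>, \<open>(y, x)\<close>.
\<close>

definition line_product :: "'v pair_pre_digraph \<Rightarrow> (int \<times> 'v) pair_pre_digraph" where
  "line_product \<Gamma> =
     \<lparr> pverts = UNIV \<times> pverts \<Gamma>,
       parcs = {((i, u), (j, v)) | i u j v. u \<in> pverts \<Gamma> \<and> v \<in> pverts \<Gamma> \<and>
                  (i = j \<and> (u, v) \<in> parcs \<Gamma> \<or> u = v \<and> \<bar>i - j\<bar> = 1)} \<rparr>"

definition edge_boundary :: "'a pair_pre_digraph \<Rightarrow> 'a pair_pre_digraph \<Rightarrow> ('a \<times> 'a) set" where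
  "edge_boundary G A = {(x, y). (x, y) \<in> parcs G \<and> x \<in> pverts A \<and> (x, y) \<notin> parcs A}"

definition vertex_boundary :: "'a pair_pre_digraph \<Rightarrow> 'a pair_pre_digraph \<Rightarrow> 'a set" where
  "vertex_boundary G A = {x \<in> pverts A. \<exists>y. (x, y) \<in> edge_boundary G A}"

definition transition_prob ::
    "'a pair_pre_digraph \<Rightarrow> ('a \<times> 'a \<Rightarrow> real) \<Rightarrow> 'a \<Rightarrow> 'a \<Rightarrow> real" where
  "transition_prob G c x y =
     (if (x, y) \<in> parcs G then c (x, y) / (\<Sum>z | (x, z) \<in> parcs G. c (x, z)) else 0)"

text \<open>
  The law \<open>\<bbbP>\<^sub>a\<close> of the walk is represented by an arbitrary realization \<open>S\<close> of
  the Markov chain on a probability space \<open>M\<close>; the Markov property conditions on the whole past.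
\<close>

locale random_walk = prob_space M
  for M :: "'w measure" +
  fixes G :: "'a pair_pre_digraph"
    and c :: "'a \<times> 'a \<Rightarrow> real"
    and a :: 'a
    and S :: "nat \<Rightarrow> 'w \<Rightarrow> 'a"
  assumes measurable_walk: "S n \<in> measurable M (count_space (pverts G))"
    and start: "AE \<omega> in M. S 0 \<omega> = a"
    and markov: "\<P>(\<omega> in M. \<forall>i\<le>n. S i \<omega> = x i) \<noteq> 0 \<Longrightarrow>
      \<P>(\<omega> in M. S (Suc n) \<omega> = y \<bar> \<forall>i\<le>n. S i \<omega> = x i) = transition_prob G c (x n) y"

definition reinforced_conductance :: "real \<Rightarrow> 'a pair_pre_digraph \<Rightarrow> 'a \<times> 'a \<Rightarrow> real" where
  "reinforced_conductance \<delta> A e = 1 + \<delta> * indicator (parcs A) e"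

definition exit_time ::
    "'a pair_pre_digraph \<Rightarrow> 'a pair_pre_digraph \<Rightarrow> (nat \<Rightarrow> 'w \<Rightarrow> 'a) \<Rightarrow> 'w \<Rightarrow> enat" where
  "exit_time G A S \<omega> = Inf {enat n | n. n \<ge> 1 \<and> (S (n - 1) \<omega>, S n \<omega>) \<in> edge_boundary G A}"

definition level_hitting_time :: "int \<Rightarrow> (nat \<Rightarrow> 'w \<Rightarrow> int \<times> 'v) \<Rightarrow> 'w \<Rightarrow> enat" where
  "level_hitting_time r S \<omega> = Inf {enat n | n. fst (S n \<omega>) = r}"

end

theory Submission
  imports Defs
begin

text \<open>
  Up to the exit time the walk is a walk on the finite graph \<open>A\<close> with unit conductances which is
  killed along each boundary arc with conductance \<open>\<epsilon> = 1 / (1 + \<delta>)\<close>. The proof is an energy estimate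
  for this killed walk. Let \<open>u x\<close> be the probability that the walk from \<open>x\<close> reaches level \<open>r\<close>
  within a given number of steps before it exits. It increases with the number of steps, so it is
  subharmonic for the killed walk below level \<open>r\<close>. Write \<open>m\<close> for the number of vertices of \<open>\<Gamma>\<close> and
  consider the flux through the horizontal edges \<open>(x, y)\<close> from level \<open>s\<close> to level \<open>s + 1\<close>,
  \<open>f s = \<Sum> u y * (u y - u x)\<close>. Multiplying the subharmonicity inequality by \<open>u\<close> and summing over a level
  (lemma \<open>energy_balance\<close>) gives \<open>f s \<ge> f (s - 1) + e s + h s\<close>, where \<open>e s\<close> is the energy of \<open>u\<close>
  inside level \<open>s\<close>, killing included, and \<open>h s\<close> is the energy on the edges from \<open>s\<close> to \<open>s + 1\<close>.
  Thus \<open>f\<close> is nonnegative and nondecreasing below level \<open>r\<close>, and it is at most \<open>m\<close>.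

  A level that contains a boundary vertex controls \<open>u\<close>: since \<open>\<Gamma>\<close> is connected, a path
  over \<open>\<Gamma>\<close> leads in this level from each of its vertices in \<open>A\<close> to the boundary vertex, and if the path
  leaves \<open>A\<close> on the way, it does so at another boundary vertex; in both cases killing occurs near by, and
  hence \<open>(u x)\<^sup>2 \<le> m / \<epsilon> * e s\<close> (lemma
  \<open>u_squared_le_slice_energy\<close>). By Cauchy-Schwarz the flux is multiplied by at least
  \<open>1 + 2 * sqrt \<epsilon> / m\<close> at such a level (lemma \<open>flux_in_geometric_growth\<close>). At every level \<open>u \<le> 1\<close>
  gives the quadratic growth \<open>f s \<ge> f (s - 1) + (f (s - 1))\<^sup>2 / m\<close>.

  The \<open>d\<close> boundary levels are used in three blocks of \<open>k\<close> levels (lemma \<open>three_stage_decay\<close>). On the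
  last block quadratic growth up to at most \<open>m\<close> forces \<open>f \<le> 2 * m / k\<close> at its start. On the
  middle block \<open>f\<close> grows geometrically, so that it is at most
  \<open>(2 * m / k) * (1 + 2 * sqrt \<epsilon> / m) ^ (- k)\<close> at the start of this block. On the
  first block the energies add up to no more than this value of \<open>f\<close>, and \<open>(u a)\<^sup>2\<close> is at most
  \<open>m / \<epsilon>\<close> times each of them, because the walk has to pass through every level between \<open>a\<close> and \<open>r\<close>.
  So \<open>(u a)\<^sup>2 \<le> 2 * m\<^sup>2 / (\<epsilon> * k\<^sup>2) * (1 + 2 * sqrt \<epsilon> / m) ^ (- k)\<close>. Thanks to the two outer blocks the
  prefactor depends on \<open>d\<^sup>2 * \<epsilon>\<close> and \<open>m\<close> only, so it is harmless when \<open>d\<^sup>2 * \<epsilon>\<close> is large, and then the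
  exponent, of order \<open>d * sqrt \<epsilon> / m\<close>, beats the cube root in the claim (lemma
  \<open>cube_root_exponential_bound\<close>). When \<open>d\<^sup>2 * \<epsilon>\<close> is not large, the claimed bound exceeds 1.
\<close>

section \<open>From flux recursions to exponential decay\<close>

lemma exp_le_one_plus_double:
  fixes x :: real assumes "0 \<le> x" "x \<le> 1" shows "exp x \<le> 1 + 2 * x"
proof -
  have "exp x \<le> 1 + x + x\<^sup>2" using assms by (rule exp_bound)
  also have "x\<^sup>2 \<le> x" using assms by (simp add: power2_eq_square mult_left_le)
  finally show ?thesis by simp
qed

text \<open>
  A discrete version of \<open>g' = g\<^sup>2 / m\<close>, whose solutions blow up in time \<open>m / g 0\<close>: as long as
  \<open>0 < g \<le> m\<close>, each step lowers the reciprocal of \<open>g\<close> by at least \<open>1 / (2 * m)\<close>.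
\<close>

lemma quadratic_growth_reciprocal:
  fixes g :: "nat \<Rightarrow> real"
  assumes step: "\<And>i. i < k \<Longrightarrow> g i + (g i)\<^sup>2 / m \<le> g (Suc i)"
    and bound: "\<And>i. i \<le> k \<Longrightarrow> g i \<le> m" and "0 \<le> g 0" "0 < m"
  shows "real k * g 0 \<le> 2 * m"
proof (cases "g 0 = 0")
  case False
  then have pos0: "0 < g 0" using assms by simp
  have pos: "0 < g i" if "i \<le> k" for i
    using that
  proof (induction i)
    case (Suc i)
    have "0 < g i + (g i)\<^sup>2 / m" using Suc \<open>0 < m\<close> by (intro add_pos_nonneg) auto
    then show ?case using step[of i] Suc by simp
  qed (use pos0 in simp)
  have rec: "1 / g (Suc i) \<le> 1 / g i - 1 / (2 * m)" if "i < k" for i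
  proof -
    have gi: "0 < g i" "g i \<le> m" using pos[of i] bound[of i] that by auto
    \<comment> \<open>The map \<open>x \<mapsto> x + x\<^sup>2 / m\<close> lowers the reciprocal of \<open>x\<close> by exactly \<open>1 / (m + x)\<close>.\<close>
    have "1 / g (Suc i) \<le> 1 / (g i + (g i)\<^sup>2 / m)"
      using step[OF that] gi \<open>0 < m\<close> by (intro divide_left_mono) (auto intro!: mult_pos_pos add_pos_nonneg pos that Suc_leI)
    also have "\<dots> = 1 / g i - 1 / (m + g i)"
      using gi \<open>0 < m\<close> by (simp add: field_simps power2_eq_square add_pos_pos)
    also have "\<dots> \<le> 1 / g i - 1 / (2 * m)"
      using gi \<open>0 < m\<close> by (intro diff_left_mono divide_left_mono) auto
    finally show ?thesis .
  qed
  have "1 / g i \<le> 1 / g 0 - real i / (2 * m)" if "i \<le> k" for i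
    using that
  proof (induction i)
    case (Suc i)
    then show ?case using rec[of i] by (simp add: add_divide_distrib)
  qed simp
  from this[of k] pos[of k] have "real k / (2 * m) \<le> 1 / g 0"
    by (smt (verit) order_refl zero_less_divide_1_iff)
  then show ?thesis using pos0 \<open>0 < m\<close> by (simp add: field_simps)
qed (use assms in simp)

text \<open>
  In the application \<open>g i\<close> is the flux through the cut after the \<open>i\<close>-th boundary level, \<open>e i\<close> is the energy in the next
  boundary level, and \<open>v\<close> is the value at the starting vertex. The first \<open>k\<close> steps bound \<open>k * v\<^sup>2\<close> by a
  multiple of \<open>g k\<close>, the next \<open>k\<close> steps bound \<open>g k\<close> geometrically by \<open>g (2 * k)\<close>, and the last \<open>k\<close> steps
  bound \<open>g (2 * k)\<close> by \<open>2 * m / k\<close>.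
\<close>

lemma three_stage_decay:
  fixes g e :: "nat \<Rightarrow> real" and k :: nat
  assumes m: "1 \<le> m" and \<epsilon>: "0 < \<epsilon>" and k: "0 < k"
    and g0: "0 \<le> g 0"
    and bound: "\<And>i. i \<le> 3 * k \<Longrightarrow> g i \<le> m"
    and energy: "\<And>i. i < 3 * k \<Longrightarrow> 0 \<le> e i" "\<And>i. i < 3 * k \<Longrightarrow> g i + e i \<le> g (Suc i)"
    and geometric: "\<And>i. i < 3 * k \<Longrightarrow> (1 + 2 * sqrt \<epsilon> / m) * g i \<le> g (Suc i)"
    and quadratic: "\<And>i. i < 3 * k \<Longrightarrow> g i + (g i)\<^sup>2 / m \<le> g (Suc i)"
    and value_le: "\<And>i. i < 3 * k \<Longrightarrow> v\<^sup>2 \<le> m / \<epsilon> * e i"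
  shows "v\<^sup>2 * (1 + 2 * sqrt \<epsilon> / m) ^ k \<le> 2 * m\<^sup>2 / (\<epsilon> * (real k)\<^sup>2)"
proof -
  let ?q = "1 + 2 * sqrt \<epsilon> / m"
  have nonneg: "0 \<le> g i" if "i \<le> 3 * k" for i
    using that
  proof (induction i)
    case (Suc i)
    then show ?case using energy[of i] by linarith
  qed (use g0 in simp)
  have "g 0 + (\<Sum>i<j. e i) \<le> g j" if "j \<le> 3 * k" for j
    using that
  proof (induction j)
    case (Suc j)
    then show ?case using energy(2)[of j] by simp
  qed simp
  from this[of k] have "(\<Sum>i<k. e i) \<le> g k" using g0 by simp
  moreover have "(\<Sum>i<k. v\<^sup>2) \<le> (\<Sum>i<k. m / \<epsilon> * e i)"
    using value_le by (intro sum_mono) simp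
  ultimately have "real k * v\<^sup>2 \<le> m / \<epsilon> * g k"
    using m \<epsilon> mult_left_mono[of "\<Sum>i<k. e i" "g k" "m / \<epsilon>"]
    by (simp add: sum_distrib_left)
  moreover have "?q ^ j * g k \<le> g (k + j)" if "j \<le> 2 * k" for j
    using that
  proof (induction j)
    case (Suc j)
    have "?q ^ Suc j * g k = ?q * (?q ^ j * g k)" by simp
    also have "\<dots> \<le> ?q * g (k + j)" using Suc m \<epsilon> by (intro mult_left_mono) auto
    also have "\<dots> \<le> g (k + Suc j)" using geometric[of "k + j"] Suc.prems by simp
    finally show ?case .
  qed simp
  from this[of k] have "?q ^ k * g k \<le> g (k + k)" by simp
  moreover have "real k * g (k + k + 0) \<le> 2 * m"
  proof (rule quadratic_growth_reciprocal)
    fix i assume "i < k"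
    then show "g (k + k + i) + (g (k + k + i))\<^sup>2 / m \<le> g (k + k + Suc i)"
      using quadratic[of "k + k + i"] by simp
  next
    fix i assume "i \<le> k"
    then show "g (k + k + i) \<le> m" by (intro bound) simp
  next
    show "0 \<le> g (k + k + 0)" by (intro nonneg) simp
  qed (use m in simp)
  ultimately have *: "real k * v\<^sup>2 \<le> m / \<epsilon> * g k" "?q ^ k * g k \<le> g (k + k)"
    "real k * g (k + k) \<le> 2 * m" by simp_all
  have "(real k * v\<^sup>2) * (?q ^ k * real k) \<le> (m / \<epsilon> * g k) * (?q ^ k * real k)"
    using *(1) m \<epsilon> by (intro mult_right_mono) auto
  also have "\<dots> = m / \<epsilon> * (real k * (?q ^ k * g k))" by simp
  also have "\<dots> \<le> m / \<epsilon> * (real k * g (k + k))"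
    using *(2) m \<epsilon> by (intro mult_left_mono) auto
  also have "\<dots> \<le> m / \<epsilon> * (2 * m)"
    using *(3) m \<epsilon> by (intro mult_left_mono) auto
  finally have "v\<^sup>2 * ?q ^ k * (real k)\<^sup>2 \<le> 2 * m\<^sup>2 / \<epsilon>"
    by (simp add: power2_eq_square mult_ac)
  then have "v\<^sup>2 * ?q ^ k \<le> 2 * m\<^sup>2 / \<epsilon> / (real k)\<^sup>2"
    using k by (subst pos_le_divide_eq) auto
  then show ?thesis by simp
qed

text \<open>
  If \<open>K = (d\<^sup>2 * \<epsilon>) powr (1 / 3)\<close> is at most \<open>4 ^ 4 * m ^ 3\<close>, the claimed bound is at least
  \<open>5 / exp 1 > 1\<close>. Otherwise \<open>K\<close> is large, so \<open>d * sqrt \<epsilon> = K powr (3 / 2)\<close> exceeds \<open>16 * K\<close>; then the prefactor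
  \<open>2 * m\<^sup>2 / (\<epsilon> * k\<^sup>2)\<close> is below 1 and the geometric factor gives more than is claimed.
\<close>

lemma cube_root_exponential_bound:
  fixes m \<epsilon> v :: real and d :: nat
  assumes m: "1 \<le> m" and \<epsilon>: "0 < \<epsilon>" "\<epsilon> \<le> 1" and v: "0 \<le> v" "v \<le> 1"
    and decay: "0 < d div 3 \<Longrightarrow>
      v\<^sup>2 * (1 + 2 * sqrt \<epsilon> / m) ^ (d div 3) \<le> 2 * m\<^sup>2 / (\<epsilon> * (real (d div 3))\<^sup>2)"
  shows "v \<le> 5 * exp (- (1 / (4 ^ 4 * m ^ 3)) * (real d ^ 2 * \<epsilon>) powr (1 / 3))"
proof -
  define K where "K = (real d ^ 2 * \<epsilon>) powr (1 / 3)"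
  have K0: "0 \<le> K" by (simp add: K_def)
  show ?thesis
  proof (cases "K \<le> 4 ^ 4 * m ^ 3")
    case True
    then have "exp (- 1) \<le> exp (- (1 / (4 ^ 4 * m ^ 3)) * K)" using m by simp
    moreover have "1 \<le> 5 * exp (- 1 :: real)" using exp_le by (simp add: exp_minus field_simps)
    ultimately have "1 \<le> 5 * exp (- (1 / (4 ^ 4 * m ^ 3)) * K)" by linarith
    then show ?thesis using v unfolding K_def by linarith
  next
    case False
    define t where "t = real d * sqrt \<epsilon>"
    have t0: "0 \<le> t" using \<epsilon> by (simp add: t_def)
    have m3: "m \<le> m ^ 3" "1 \<le> m ^ 3" using m by (auto simp: self_le_power)
    have K256: "256 \<le> K" using False m3 by simp
    have d0: "d \<noteq> 0" using K256 by (auto simp: K_def intro!: Nat.gr0I)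
    have "K ^ 3 = real d ^ 2 * \<epsilon>"
      unfolding K_def using d0 \<epsilon> by (simp add: powr_power)
    also have "\<dots> = t\<^sup>2" using \<epsilon> by (simp add: t_def power_mult_distrib)
    finally have Kt: "K ^ 3 = t\<^sup>2" .
    have "(16 * K)\<^sup>2 = 256 * K\<^sup>2" by (simp add: power_mult_distrib)
    also have "\<dots> \<le> K * K\<^sup>2" using K256 by (intro mult_right_mono) auto
    also have "\<dots> = t\<^sup>2" using Kt by (simp add: power2_eq_square power3_eq_cube)
    finally have tK: "16 * K \<le> t" using t0 by (rule power2_le_imp_le)
    define k where "k = d div 3"
    have "sqrt \<epsilon> \<le> 1" using \<epsilon> by simp
    then have "t \<le> real d" by (simp add: t_def mult_left_le)
    then have d: "4096 \<le> d" using tK K256 by linarith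
    have k4: "real d \<le> 4 * real k" using d unfolding k_def by linarith
    have k0: "0 < k" using d by (simp add: k_def)
    define z where "z = real k * sqrt \<epsilon>"
    have "t \<le> 4 * z" using mult_right_mono[OF k4, of "sqrt \<epsilon>"] \<epsilon> by (simp add: t_def z_def mult_ac)
    then have zK: "4 * K \<le> z" using tK by linarith
    have zm: "1024 * m \<le> z" using zK False m3 by simp
    have "exp (z / m) = exp (sqrt \<epsilon> / m) ^ k"
      by (simp add: z_def flip: exp_of_nat_mult)
    also have "\<dots> \<le> (1 + 2 * (sqrt \<epsilon> / m)) ^ k"
    proof (intro power_mono exp_le_one_plus_double)
      have "sqrt \<epsilon> \<le> m" using m \<open>sqrt \<epsilon> \<le> 1\<close> by linarith
      then show "sqrt \<epsilon> / m \<le> 1" using m by (simp add: divide_le_eq)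
    qed (use m \<epsilon> in auto)
    finally have "v\<^sup>2 * exp (z / m) \<le> v\<^sup>2 * (1 + 2 * sqrt \<epsilon> / m) ^ k"
      by (intro mult_left_mono) auto
    also have "\<dots> \<le> 2 * m\<^sup>2 / z\<^sup>2"
      using decay k0 \<epsilon> by (simp add: k_def z_def power_mult_distrib mult_ac)
    also have "\<dots> \<le> 1"
    proof -
      have "2 * m\<^sup>2 \<le> (1024 * m)\<^sup>2" by (simp add: power_mult_distrib)
      also have "\<dots> \<le> z\<^sup>2" using zm m by (intro power_mono) auto
      finally show ?thesis using zm m by (simp add: divide_le_eq)
    qed
    finally have "v\<^sup>2 \<le> exp (- (z / m))" by (simp add: exp_minus field_simps)
    also have "\<dots> \<le> exp (- (4 * K / m))" using zK m by (simp add: divide_right_mono)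
    also have "\<dots> = (exp (- (2 * K / m)))\<^sup>2" by (simp flip: exp_double)
    finally have "v \<le> exp (- (2 * K / m))" by (rule power2_le_imp_le) simp
    also have "\<dots> \<le> exp (- (1 / (4 ^ 4 * m ^ 3)) * K)"
    proof -
      have "K / (4 ^ 4 * m ^ 3) \<le> K / m"
        using m m3 K0 by (intro divide_left_mono) auto
      also have "\<dots> \<le> 2 * K / m" using m K0 by (intro divide_right_mono) auto
      finally show ?thesis by simp
    qed
    also have "\<dots> \<le> 5 * \<dots>" by simp
    finally show ?thesis by (simp add: K_def)
  qed
qed

section \<open>Finite subgraphs of the product of a line and a finite graph\<close>

locale line_subgraph =
  fixes \<Gamma> :: "'v pair_pre_digraph" and A :: "(int \<times> 'v) pair_pre_digraph"
  assumes base_graph: "pair_graph \<Gamma>"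
    and base_connected: "Digraph_Component.connected (with_proj \<Gamma>)"
    and graph: "pair_graph A"
    and sub: "subgraph (with_proj A) (with_proj (line_product \<Gamma>))"
begin

sublocale \<Gamma>: pair_graph \<Gamma> by (rule base_graph)
sublocale A: pair_graph A by (rule graph)

abbreviation "V \<equiv> pverts A"
abbreviation "E \<equiv> parcs A"
abbreviation "width \<equiv> real (card (pverts \<Gamma>))"

definition slice :: "int \<Rightarrow> (int \<times> 'v) set" where
  "slice s = {x \<in> V. fst x = s}"

definition arcs_between :: "int \<Rightarrow> int \<Rightarrow> ((int \<times> 'v) \<times> (int \<times> 'v)) set" where
  "arcs_between s t = {(x, y) \<in> E. fst x = s \<and> fst y = t}"

text \<open>
  The outer ends of the boundary arcs at \<open>x\<close>; such an end may itself be a vertex of \<open>A\<close>. Their number is the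
  total conductance that leaves \<open>A\<close> at \<open>x\<close>.
\<close>

definition exits :: "int \<times> 'v \<Rightarrow> (int \<times> 'v) set" where
  "exits x = {y. (x, y) \<in> edge_boundary (line_product \<Gamma>) A}"

lemma finite_V [simp]: "finite V" and finite_E [simp]: "finite E"
  using A.pair_finite_verts A.pair_finite_arcs by auto

lemma finite_arcs_from [simp]: "finite {y. (x, y) \<in> E}"
  by (rule finite_subset[of _ "snd ` E"]) force+

lemma arc_sym: "(x, y) \<in> E \<Longrightarrow> (y, x) \<in> E"
  using A.pair_sym_arcs by (cases x; cases y) (auto simp: symmetric_def sym_def)

lemma V_subset: "x \<in> V \<Longrightarrow> snd x \<in> pverts \<Gamma>"
  and E_subset: "E \<subseteq> parcs (line_product \<Gamma>)"
  using sub by (auto simp: subgraph_def line_product_def)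

lemma arc_cases:
  assumes "(x, y) \<in> E"
  obtains "fst y = fst x" | "fst y = fst x + 1" "snd y = snd x" | "fst y = fst x - 1" "snd y = snd x"
  using E_subset assms by (fastforce simp: line_product_def abs_if split: if_splits)

lemma width_ge_1: "1 \<le> width"
proof -
  have "pverts \<Gamma> \<noteq> {}"
    using base_connected by (auto simp: connected_def strongly_connected_def)
  then have "0 < card (pverts \<Gamma>)" using \<Gamma>.pair_finite_verts by (simp add: card_gt_0_iff)
  then show ?thesis by simp
qed

lemma finite_slice [simp]: "finite (slice s)"
  by (simp add: slice_def)

lemma finite_arcs_between [simp]: "finite (arcs_between s t)"
  by (rule finite_subset[OF _ finite_E]) (auto simp: arcs_between_def)

lemma card_slice_le: "real (card (slice s)) \<le> width"
proof -
  have "card (slice s) \<le> card (pverts \<Gamma>)"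
    by (rule card_inj_on_le[where f = snd])
       (auto simp: slice_def inj_on_def \<Gamma>.pair_finite_verts prod_eq_iff dest: V_subset)
  then show ?thesis by simp
qed

lemma rightward_arcs:
  "inj_on fst (arcs_between s (s + 1))" "fst ` arcs_between s (s + 1) \<subseteq> slice s"
proof -
  show "inj_on fst (arcs_between s (s + 1))"
    by (auto simp: inj_on_def arcs_between_def elim!: arc_cases)
  show "fst ` arcs_between s (s + 1) \<subseteq> slice s"
    by (auto simp: arcs_between_def slice_def dest: A.in_arcsD1)
qed

lemma finite_neighbours: "finite {y. (x, y) \<in> parcs (line_product \<Gamma>)}"
  by (rule finite_subset[of _ "{fst x - 1..fst x + 1} \<times> pverts \<Gamma>"])
     (auto simp: line_product_def \<Gamma>.pair_finite_verts)

lemma finite_exits [simp]: "finite (exits x)"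
  by (rule finite_subset[OF _ finite_neighbours[of x]]) (auto simp: exits_def edge_boundary_def)

lemma arcs_between_reverse: "arcs_between t s = prod.swap ` arcs_between s t"
  using arc_sym by (force simp: arcs_between_def image_iff)

lemma neighbours_split:
  "{y. (x, y) \<in> parcs (line_product \<Gamma>)} = {y. (x, y) \<in> E} \<union> exits x"
  if "x \<in> V" for x
  using that E_subset by (auto simp: exits_def edge_boundary_def)

lemma base_path:
  assumes "\<beta> \<in> pverts \<Gamma>" "\<gamma> \<in> pverts \<Gamma>"
  obtains p where "\<Gamma>.apath \<gamma> p \<beta>"
proof -
  have "\<gamma> \<rightarrow>\<^sup>*\<^bsub>mk_symmetric (with_proj \<Gamma>)\<^esub> \<beta>"
    using base_connected assms by (auto simp: connected_def strongly_connected_def)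
  then have "\<gamma> \<rightarrow>\<^sup>*\<^bsub>with_proj \<Gamma>\<^esub> \<beta>"
    using \<Gamma>.reachable_mk_symmetric_eq[OF \<Gamma>.pair_sym_arcs] by simp
  then show ?thesis using that \<Gamma>.reachable_apath by blast
qed

end

section \<open>Energy estimates for subharmonic functions of the killed walk\<close>

text \<open>
  The inequality \<open>subharmonic\<close> says that \<open>u\<close> is subharmonic for the walk on \<open>A\<close> with unit conductances in which
  every boundary arc leads to a cemetery state, where \<open>u\<close> is 0, through an edge of conductance \<open>\<epsilon>\<close>.
\<close>

locale killed_subharmonic = line_subgraph \<Gamma> A
  for \<Gamma> :: "'v pair_pre_digraph" and A :: "(int \<times> 'v) pair_pre_digraph" +
  fixes u :: "int \<times> 'v \<Rightarrow> real" and \<epsilon> :: real and r :: int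
  assumes rate: "0 < \<epsilon>" "\<epsilon> \<le> 1"
    and u_nonneg: "x \<in> V \<Longrightarrow> 0 \<le> u x" and u_le_1: "x \<in> V \<Longrightarrow> u x \<le> 1"
    and subharmonic: "x \<in> V \<Longrightarrow> fst x < r \<Longrightarrow>
      (\<Sum>y | (x, y) \<in> E. u x - u y) + \<epsilon> * real (card (exits x)) * u x \<le> 0"
begin

text \<open>
  Both fluxes pass through the cut between the levels \<open>s\<close> and \<open>s + 1\<close>: the current of \<open>u\<close> along an edge is
  weighted with the value of \<open>u\<close> at the end where it enters level \<open>s + 1\<close>, or at the end where it leaves
  level \<open>s\<close>. Their difference is the energy on the cut.
\<close>

definition flux_in :: "int \<Rightarrow> real" where
  "flux_in s = (\<Sum>(x, y)\<in>arcs_between s (s + 1). u y * (u y - u x))"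

definition flux_out :: "int \<Rightarrow> real" where
  "flux_out s = (\<Sum>(x, y)\<in>arcs_between s (s + 1). u x * (u y - u x))"

definition crossing_energy :: "int \<Rightarrow> real" where
  "crossing_energy s = (\<Sum>(x, y)\<in>arcs_between s (s + 1). (u y - u x)\<^sup>2)"

definition killing_energy :: "int \<Rightarrow> real" where
  "killing_energy s = (\<Sum>x\<in>slice s. \<epsilon> * real (card (exits x)) * (u x)\<^sup>2)"

text \<open>
  The factor \<open>1 / 2\<close> compensates that every undirected edge occurs as two arcs.
\<close>

definition slice_energy :: "int \<Rightarrow> real" where
  "slice_energy s = (\<Sum>(x, y)\<in>arcs_between s s. (u x - u y)\<^sup>2) / 2 + killing_energy s"

lemma flux_in_eq: "flux_in s = flux_out s + crossing_energy s"
  by (simp add: flux_in_def flux_out_def crossing_energy_def flip: sum.distrib)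
     (auto intro!: sum.cong simp: power2_eq_square algebra_simps)

lemma crossing_energy_nonneg: "0 \<le> crossing_energy s"
  by (auto simp: crossing_energy_def intro!: sum_nonneg)

lemma killing_energy_nonneg: "0 \<le> killing_energy s"
  using rate by (auto simp: killing_energy_def intro!: sum_nonneg)

lemma slice_energy_nonneg: "0 \<le> slice_energy s"
  using killing_energy_nonneg by (auto simp: slice_energy_def intro!: sum_nonneg add_nonneg_nonneg)

text \<open>
  Summation by parts inside a level: reversing all arcs and averaging the two sums symmetrizes the summand.
\<close>

lemma flat_green:
  "(\<Sum>(x, y)\<in>arcs_between s s. u x * (u x - u y)) = (\<Sum>(x, y)\<in>arcs_between s s. (u x - u y)\<^sup>2) / 2"
proof -
  have "(\<Sum>(x, y)\<in>arcs_between s s. u x * (u x - u y)) =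
      (\<Sum>(x, y)\<in>arcs_between s s. u y * (u y - u x))"
    by (subst arcs_between_reverse) (simp add: sum.reindex case_prod_unfold)
  then have "2 * (\<Sum>(x, y)\<in>arcs_between s s. u x * (u x - u y)) =
      (\<Sum>(x, y)\<in>arcs_between s s. u x * (u x - u y) + u y * (u y - u x))"
    by (simp add: sum.distrib case_prod_unfold)
  also have "\<dots> = (\<Sum>(x, y)\<in>arcs_between s s. (u x - u y)\<^sup>2)"
    by (auto intro!: sum.cong simp: power2_eq_square algebra_simps)
  finally show ?thesis by simp
qed

text \<open>
  Green's formula on one level: multiply the subharmonicity inequality at \<open>x\<close> by \<open>u x \<ge> 0\<close> and
  sum over the level. The arcs to the right give minus the flux out, those to the left the flux in through
  the preceding cut, and those within the level together with the killing give its energy.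
\<close>

lemma energy_balance:
  assumes "s < r"
  shows "flux_in (s - 1) + slice_energy s \<le> flux_out s"
proof -
  define h where "h = (\<lambda>(x, y). u x * (u x - u y))"
  have "(\<Sum>x\<in>slice s. \<Sum>y | (x, y) \<in> E. u x * (u x - u y)) =
      sum h (SIGMA x:slice s. {y. (x, y) \<in> E})"
    unfolding h_def by (rule sum.Sigma) auto
  also have "(SIGMA x:slice s. {y. (x, y) \<in> E}) =
      arcs_between s s \<union> (arcs_between s (s + 1) \<union> arcs_between s (s - 1))"
    using A.in_arcsD1 by (auto simp: slice_def arcs_between_def elim: arc_cases)
  also have "sum h \<dots> = sum h (arcs_between s s) +
      sum h (arcs_between s (s + 1) \<union> arcs_between s (s - 1))"
    by (intro sum.union_disjoint finite_UnI finite_arcs_between) (auto simp: arcs_between_def)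
  also have "sum h (arcs_between s (s + 1) \<union> arcs_between s (s - 1)) =
      sum h (arcs_between s (s + 1)) + sum h (arcs_between s (s - 1))"
    by (intro sum.union_disjoint finite_arcs_between) (auto simp: arcs_between_def)
  also have "sum h (arcs_between s (s + 1)) = - flux_out s"
    by (auto simp: h_def flux_out_def right_diff_distrib intro!: sum.cong simp flip: sum_negf)
  also have "sum h (arcs_between s (s - 1)) = flux_in (s - 1)"
    by (subst arcs_between_reverse) (simp add: sum.reindex h_def flux_in_def case_prod_unfold)
  also have "sum h (arcs_between s s) = (\<Sum>(x, y)\<in>arcs_between s s. (u x - u y)\<^sup>2) / 2"
    unfolding h_def by (rule flat_green)
  finally have "(\<Sum>x\<in>slice s. \<Sum>y | (x, y) \<in> E. u x * (u x - u y)) + killing_energy s =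
      slice_energy s + (flux_in (s - 1) - flux_out s)"
    by (simp add: slice_energy_def h_def)
  moreover have "(\<Sum>x\<in>slice s. \<Sum>y | (x, y) \<in> E. u x * (u x - u y)) + killing_energy s =
      (\<Sum>x\<in>slice s. u x * ((\<Sum>y | (x, y) \<in> E. u x - u y) + \<epsilon> * real (card (exits x)) * u x))"
    unfolding killing_energy_def sum.distrib[symmetric]
    by (intro sum.cong) (auto simp: distrib_left sum_distrib_left power2_eq_square)
  moreover have "\<dots> \<le> 0"
    using assms by (intro sum_nonpos mult_nonneg_nonpos u_nonneg subharmonic) (auto simp: slice_def)
  ultimately show ?thesis by linarith
qed

lemma flux_in_mono:
  assumes "s \<le> t" "t < r"
  shows "flux_in s \<le> flux_in t"
  using assms
proof (induction t rule: int_ge_induct)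
  case (step t)
  then show ?case
    using energy_balance[of "t + 1"] flux_in_eq[of "t + 1"] crossing_energy_nonneg[of "t + 1"]
      slice_energy_nonneg[of "t + 1"] by simp
qed simp

text \<open>
  To the left of the finite graph \<open>A\<close> the flux is 0, and it increases from level to level.
\<close>

lemma flux_in_nonneg:
  assumes "s < r"
  shows "0 \<le> flux_in s"
proof -
  define l where "l = Min (insert s (fst ` V)) - 1"
  have "l < fst x" if "x \<in> V" for x
  proof -
    have "Min (insert s (fst ` V)) \<le> fst x" using that by (intro Min_le) auto
    then show ?thesis by (simp add: l_def)
  qed
  then have "arcs_between l (l + 1) = {}"
    using A.in_arcsD1 by (force simp: arcs_between_def)
  then have "flux_in l = 0" by (simp add: flux_in_def)
  moreover have "l \<le> s"
  proof -
    have "Min (insert s (fst ` V)) \<le> s" by (intro Min_le) auto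
    then show ?thesis unfolding l_def by linarith
  qed
  ultimately show ?thesis using flux_in_mono[of l s] assms by simp
qed

lemma flux_in_le_width: "flux_in s \<le> width"
proof -
  have "flux_in s \<le> (\<Sum>p\<in>arcs_between s (s + 1). 1)"
    unfolding flux_in_def
  proof (rule sum_mono, clarify)
    fix i v j w assume "((i, v), (j, w)) \<in> arcs_between s (s + 1)"
    then have *: "(i, v) \<in> V" "(j, w) \<in> V"
      using A.in_arcsD1 A.in_arcsD2 by (auto simp: arcs_between_def)
    have "u (j, w) * (u (j, w) - u (i, v)) \<le> 1 * 1"
    proof (cases "u (i, v) \<le> u (j, w)")
      case True
      have "u (j, w) - u (i, v) \<le> 1" using u_le_1[OF *(2)] u_nonneg[OF *(1)] by linarith
      then show ?thesis using True u_le_1[OF *(2)] by (intro mult_mono) auto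
    next
      case False
      then show ?thesis using mult_nonneg_nonpos[OF u_nonneg[OF *(2)], of "u (j, w) - u (i, v)"]
        by simp
    qed
    then show "u (j, w) * (u (j, w) - u (i, v)) \<le> 1" by simp
  qed
  also have "\<dots> = real (card (fst ` arcs_between s (s + 1)))"
    using rightward_arcs(1) by (simp add: card_image)
  also have "\<dots> \<le> real (card (slice s))"
    using card_mono[OF finite_slice rightward_arcs(2)[of s]] by simp
  finally show ?thesis using card_slice_le[of s] by linarith
qed

text \<open>
  Cauchy-Schwarz; every vertex of the level has at most one edge to the right, so the weights \<open>(u x)\<^sup>2\<close> are
  counted at most once.
\<close>

lemma flux_out_squared_le:
  assumes "\<And>x. x \<in> slice s \<Longrightarrow> (u x)\<^sup>2 \<le> q"
  shows "(flux_out s)\<^sup>2 \<le> width * q * crossing_energy s"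
proof (cases "slice s = {}")
  case True
  then have "arcs_between s (s + 1) = {}" using rightward_arcs(2)[of s] by auto
  then show ?thesis by (simp add: flux_out_def crossing_energy_def)
next
  case False
  then have q: "0 \<le> q" using assms zero_le_power2 order_trans by blast
  let ?R = "arcs_between s (s + 1)"
  have "(\<Sum>p\<in>?R. (u (fst p))\<^sup>2) = (\<Sum>x\<in>fst ` ?R. (u x)\<^sup>2)"
    using rightward_arcs(1) by (simp add: sum.reindex)
  also have "\<dots> \<le> (\<Sum>x\<in>slice s. (u x)\<^sup>2)"
    using rightward_arcs(2) by (intro sum_mono2) auto
  also have "\<dots> \<le> real (card (slice s)) * q"
    using sum_bounded_above[of "slice s" "\<lambda>x. (u x)\<^sup>2" q] assms by simp
  also have "\<dots> \<le> width * q" using card_slice_le q by (intro mult_right_mono)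
  finally have U: "(\<Sum>p\<in>?R. (u (fst p))\<^sup>2) \<le> width * q" .
  have "(flux_out s)\<^sup>2 \<le> (\<Sum>p\<in>?R. (u (fst p))\<^sup>2) * (\<Sum>p\<in>?R. (u (snd p) - u (fst p))\<^sup>2)"
    unfolding flux_out_def case_prod_unfold by (rule Cauchy_Schwarz_ineq_sum)
  also have "(\<Sum>p\<in>?R. (u (snd p) - u (fst p))\<^sup>2) = crossing_energy s"
    by (simp add: crossing_energy_def case_prod_unfold)
  also have "(\<Sum>p\<in>?R. (u (fst p))\<^sup>2) * crossing_energy s \<le> width * q * crossing_energy s"
    using U crossing_energy_nonneg by (rule mult_right_mono)
  finally show ?thesis .
qed

text \<open>
  Here Cauchy-Schwarz is used with the trivial bound \<open>u \<le> 1\<close>, so that a flux is turned into energy on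
  the next cut.
\<close>

lemma flux_in_quadratic_growth:
  assumes "s < r"
  shows "flux_in (s - 1) + (flux_in (s - 1))\<^sup>2 / width \<le> flux_in s"
proof -
  have "(flux_in (s - 1))\<^sup>2 \<le> (flux_out s)\<^sup>2"
    using energy_balance[OF assms] slice_energy_nonneg[of s] flux_in_nonneg[of "s - 1"] assms
    by (intro power_mono) auto
  also have "\<dots> \<le> width * 1 * crossing_energy s"
    by (rule flux_out_squared_le) (auto simp: slice_def u_nonneg u_le_1 power_le_one)
  finally have "(flux_in (s - 1))\<^sup>2 / width \<le> crossing_energy s"
    using width_ge_1 by (simp add: divide_le_eq mult.commute)
  then show ?thesis
    using energy_balance[OF assms] slice_energy_nonneg[of s] flux_in_eq[of s] by linarith
qed

lemma boundary_killing_energy: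
  assumes "x \<in> vertex_boundary (line_product \<Gamma>) A" "fst x = s"
  shows "\<epsilon> * (u x)\<^sup>2 \<le> killing_energy s"
proof -
  have x: "x \<in> slice s" using assms by (auto simp: vertex_boundary_def slice_def)
  have "exits x \<noteq> {}" using assms by (auto simp: vertex_boundary_def exits_def)
  then have "1 \<le> card (exits x)" by (simp add: Suc_le_eq card_gt_0_iff)
  then have "\<epsilon> * 1 * (u x)\<^sup>2 \<le> \<epsilon> * real (card (exits x)) * (u x)\<^sup>2"
    using rate by (intro mult_right_mono mult_left_mono) auto
  also have "\<dots> \<le> killing_energy s"
    unfolding killing_energy_def using x rate
    by (intro member_le_sum[of x "slice s" "\<lambda>x. \<epsilon> * real (card (exits x)) * (u x)\<^sup>2"]) auto
  finally show ?thesis by simp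
qed

text \<open>
  The energy on the edges of level \<open>s\<close> with both ends over \<open>W\<close>. A path is recorded by the set of its
  vertices rather than by its edges, because the vertex set grows by one new vertex at each step.
\<close>

definition energy_within :: "int \<Rightarrow> 'v set \<Rightarrow> real" where
  "energy_within s W =
     (\<Sum>(x, y) | (x, y) \<in> arcs_between s s \<and> snd x \<in> W \<and> snd y \<in> W. (u x - u y)\<^sup>2) / 2"

lemma finite_arcs_within: "finite {(x, y). (x, y) \<in> arcs_between s s \<and> snd x \<in> W \<and> snd y \<in> W}"
  by (rule finite_subset[OF _ finite_arcs_between[of s s]]) auto

lemma energy_within_nonneg: "0 \<le> energy_within s W"
  by (auto simp: energy_within_def intro!: sum_nonneg)

lemma energy_within_le: "energy_within s W + killing_energy s \<le> slice_energy s"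
  unfolding energy_within_def slice_energy_def
  by (intro add_right_mono divide_right_mono sum_mono2) auto

text \<open>
  The edge to the new vertex contributes both of its arcs, which makes up for the factor \<open>1 / 2\<close>.
\<close>

lemma energy_within_insert:
  assumes "((s, \<gamma>), (s, \<gamma>')) \<in> E" "\<gamma>' \<in> W" "\<gamma> \<notin> W"
  shows "energy_within s W + (u (s, \<gamma>) - u (s, \<gamma>'))\<^sup>2 \<le> energy_within s (insert \<gamma> W)"
proof -
  let ?D = "\<lambda>W. {(x, y). (x, y) \<in> arcs_between s s \<and> snd x \<in> W \<and> snd y \<in> W}"
  let ?f = "\<lambda>(x, y). (u x - u y)\<^sup>2"
  let ?N = "{((s, \<gamma>), (s, \<gamma>')), ((s, \<gamma>'), (s, \<gamma>))}"
  have "sum ?f (?D W) + sum ?f ?N = sum ?f (?D W \<union> ?N)"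
    using assms by (intro sum.union_disjoint[symmetric] finite_arcs_within) auto
  also have "\<dots> \<le> sum ?f (?D (insert \<gamma> W))"
    using assms arc_sym[OF assms(1)]
    by (intro sum_mono2 finite_arcs_within) (auto simp: arcs_between_def)
  also have "sum ?f ?N = 2 * (u (s, \<gamma>) - u (s, \<gamma>'))\<^sup>2"
  proof -
    have "\<gamma> \<noteq> \<gamma>'" using assms by blast
    then show ?thesis by (simp add: power2_commute[of "u (s, \<gamma>)"])
  qed
  finally show ?thesis by (simp add: energy_within_def)
qed

text \<open>
  The path in \<open>\<Gamma>\<close> is followed inside level \<open>s\<close> for as long as its edges belong to \<open>A\<close>. If one of them does
  not, the current vertex is already a boundary vertex; otherwise the path arrives at \<open>(s, \<beta>)\<close>. Either
  way it ends with a killing edge, of resistance \<open>1 / \<epsilon>\<close>, after at most \<open>length p\<close> edges of resistance 1,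
  and \<open>u\<close> vanishes in the cemetery: the square of a potential difference is at most the resistance times
  the energy.
\<close>

lemma u_squared_le_path_energy:
  assumes "\<Gamma>.apath \<gamma> p \<beta>" "(s, \<gamma>) \<in> V" "(s, \<beta>) \<in> vertex_boundary (line_product \<Gamma>) A"
  shows "(u (s, \<gamma>))\<^sup>2 \<le> (1 / \<epsilon> + real (length p)) *
    (energy_within s (set (pawalk_verts \<gamma> p)) + killing_energy s)"
  using assms
proof (induction p arbitrary: \<gamma>)
  case Nil
  then have "(s, \<gamma>) \<in> vertex_boundary (line_product \<Gamma>) A" by (simp add: \<Gamma>.apath_Nil_iff)
  then have "\<epsilon> * (u (s, \<gamma>))\<^sup>2 \<le> killing_energy s" by (rule boundary_killing_energy) simp
  then have "(u (s, \<gamma>))\<^sup>2 \<le> 1 / \<epsilon> * killing_energy s"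
    using rate by (simp add: pos_le_divide_eq mult.commute)
  also have "\<dots> \<le> 1 / \<epsilon> * (energy_within s (set (pawalk_verts \<gamma> [])) + killing_energy s)"
    using rate energy_within_nonneg by (intro mult_left_mono) auto
  finally show ?case by simp
next
  case (Cons e p)
  obtain \<gamma>' where e: "e = (\<gamma>, \<gamma>')" "(\<gamma>, \<gamma>') \<in> parcs \<Gamma>" and p: "\<Gamma>.apath \<gamma>' p \<beta>"
    and new: "\<gamma> \<notin> set (pawalk_verts \<gamma>' p)"
    using Cons.prems(1) by (cases e) (auto simp: \<Gamma>.apath_Cons_iff)
  let ?W = "set (pawalk_verts \<gamma>' p)"
  have \<gamma>'W: "\<gamma>' \<in> ?W" using \<Gamma>.hd_in_awalk_verts(2)[OF p] by simp
  show ?case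
  proof (cases "((s, \<gamma>), (s, \<gamma>')) \<in> E")
    case True
    define C where "C = 1 / \<epsilon> + real (length p)"
    define Q where "Q = energy_within s ?W + killing_energy s"
    define b where "b = u (s, \<gamma>')"
    define t where "t = u (s, \<gamma>) - b"
    have C: "0 < C" using rate by (simp add: C_def add_pos_nonneg)
    have "(s, \<gamma>') \<in> V" using True A.in_arcsD2 by blast
    then have "b\<^sup>2 \<le> C * Q" unfolding b_def C_def Q_def by (rule Cons.IH[OF p _ Cons.prems(3)])
    then have "b\<^sup>2 / C \<le> Q" using C by (simp add: pos_divide_le_eq mult.commute)
    \<comment> \<open>Cauchy-Schwarz for a resistor \<open>C\<close> in series with a unit resistor, with the defect written out.\<close>
    have "(b + t)\<^sup>2 \<le> (b + t)\<^sup>2 + (b - C * t)\<^sup>2 / C" using C by simp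
    also have "\<dots> = (C + 1) * (b\<^sup>2 / C + t\<^sup>2)"
      using C by (simp add: field_simps power2_eq_square)
    also have "\<dots> \<le> (C + 1) * (Q + t\<^sup>2)"
      using C \<open>b\<^sup>2 / C \<le> Q\<close> by (intro mult_left_mono) auto
    also have "\<dots> \<le> (C + 1) * (energy_within s (insert \<gamma> ?W) + killing_energy s)"
      using C energy_within_insert[OF True \<gamma>'W new] by (intro mult_left_mono) (auto simp: Q_def t_def b_def)
    finally show ?thesis by (simp add: C_def t_def b_def e ac_simps)
  next
    case False
    have "((s, \<gamma>), (s, \<gamma>')) \<in> edge_boundary (line_product \<Gamma>) A"
      using False e(2) Cons.prems(2) \<Gamma>.in_arcsD1 \<Gamma>.in_arcsD2
      by (auto simp: edge_boundary_def line_product_def)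
    then have "\<epsilon> * (u (s, \<gamma>))\<^sup>2 \<le> killing_energy s"
      using Cons.prems(2) by (intro boundary_killing_energy) (auto simp: vertex_boundary_def)
    then have "(u (s, \<gamma>))\<^sup>2 \<le> 1 / \<epsilon> * killing_energy s"
      using rate by (simp add: pos_le_divide_eq mult.commute)
    also have "\<dots> \<le> (1 / \<epsilon> + real (length (e # p))) *
        (energy_within s (set (pawalk_verts \<gamma> (e # p))) + killing_energy s)"
      using rate energy_within_nonneg killing_energy_nonneg by (intro mult_mono) auto
    finally show ?thesis .
  qed
qed

lemma u_squared_le_slice_energy:
  assumes "x \<in> slice s" "b \<in> vertex_boundary (line_product \<Gamma>) A" "fst b = s"
  shows "(u x)\<^sup>2 \<le> width / \<epsilon> * slice_energy s"
proof -
  obtain \<gamma> \<beta> where [simp]: "x = (s, \<gamma>)" "b = (s, \<beta>)"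
    using assms by (cases x; cases b) (auto simp: slice_def)
  have \<gamma>: "(s, \<gamma>) \<in> V" "\<gamma> \<in> pverts \<Gamma>" using assms(1) V_subset by (force simp: slice_def)+
  have "\<beta> \<in> pverts \<Gamma>" using assms(2) V_subset by (force simp: vertex_boundary_def)
  then obtain p where p: "\<Gamma>.apath \<gamma> p \<beta>" using base_path \<gamma> by blast
  have "length p < card (pverts \<Gamma>)" using \<Gamma>.length_apath_less[OF p] .
  then have len: "1 + real (length p) \<le> width" by linarith
  have "(u x)\<^sup>2 \<le> (1 / \<epsilon> + real (length p)) *
      (energy_within s (set (pawalk_verts \<gamma> p)) + killing_energy s)"
    using u_squared_le_path_energy[OF p \<gamma>(1)] assms(2) by simp
  also have "\<dots> \<le> width / \<epsilon> * slice_energy s"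
  proof (rule mult_mono)
    have "real (length p) \<le> real (length p) / \<epsilon>"
      using rate by (simp add: pos_le_divide_eq mult_left_le)
    then have "1 / \<epsilon> + real (length p) \<le> (1 + real (length p)) / \<epsilon>" by (simp add: add_divide_distrib)
    also have "\<dots> \<le> width / \<epsilon>" using len rate by (intro divide_right_mono) auto
    finally show "1 / \<epsilon> + real (length p) \<le> width / \<epsilon>" .
  qed (use energy_within_le energy_within_nonneg killing_energy_nonneg rate in auto)
  finally show ?thesis .
qed

text \<open>
  On a level with a boundary vertex the energy \<open>e\<close> of the level bounds \<open>u\<close>, so Cauchy-Schwarz gives
  \<open>(flux_out s)\<^sup>2 \<le> m\<^sup>2 / \<epsilon> * e * h\<close> with \<open>h\<close> the energy on the cut. As \<open>4 * e * h \<le> (e + h)\<^sup>2\<close>, the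
  increment \<open>e + h\<close> of the flux is at least \<open>2 * sqrt \<epsilon> / m\<close> times the flux.
\<close>

lemma flux_in_geometric_growth:
  assumes "s < r" "b \<in> vertex_boundary (line_product \<Gamma>) A" "fst b = s"
  shows "(1 + 2 * sqrt \<epsilon> / width) * flux_in (s - 1) \<le> flux_in s"
proof -
  define e h where "e = slice_energy s" and "h = crossing_energy s"
  have eh: "0 \<le> e" "0 \<le> h" by (simp_all add: e_def h_def slice_energy_nonneg crossing_energy_nonneg)
  have balance: "flux_in (s - 1) + e \<le> flux_out s" "flux_in s = flux_out s + h"
    using energy_balance[OF assms(1)] flux_in_eq by (auto simp: e_def h_def)
  have "(2 * sqrt \<epsilon> * flux_out s)\<^sup>2 = 4 * \<epsilon> * (flux_out s)\<^sup>2"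
    using rate by (simp add: power_mult_distrib)
  also have "(flux_out s)\<^sup>2 \<le> width * (width / \<epsilon> * e) * h"
    unfolding e_def h_def by (rule flux_out_squared_le) (rule u_squared_le_slice_energy[OF _ assms(2,3)])
  then have "4 * \<epsilon> * (flux_out s)\<^sup>2 \<le> 4 * \<epsilon> * (width * (width / \<epsilon> * e) * h)"
    using rate by (intro mult_left_mono) auto
  also have "\<dots> = width\<^sup>2 * (4 * e * h)" using rate by (simp add: power2_eq_square)
  also have "\<dots> \<le> width\<^sup>2 * (e + h)\<^sup>2"
    using sum_squares_ge_zero[of "e - h" 0] by (intro mult_left_mono) (auto simp: power2_eq_square algebra_simps)
  also have "\<dots> = (width * (e + h))\<^sup>2" by (simp add: power_mult_distrib)
  finally have "2 * sqrt \<epsilon> * flux_out s \<le> width * (e + h)"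
    by (rule power2_le_imp_le) (use eh in simp)
  moreover have "2 * sqrt \<epsilon> * flux_in (s - 1) \<le> 2 * sqrt \<epsilon> * flux_out s"
    using balance eh rate by (intro mult_left_mono) auto
  ultimately have "2 * sqrt \<epsilon> * flux_in (s - 1) \<le> (e + h) * width"
    by (simp only: mult.commute[of width])
  then have "2 * sqrt \<epsilon> * flux_in (s - 1) / width \<le> e + h"
    using width_ge_1 by (subst pos_divide_le_eq) auto
  then show ?thesis using balance by (simp add: distrib_right)
qed

text \<open>
  The number \<open>v\<close> stands for the value of \<open>u\<close> at a vertex of level \<open>l 0\<close>, which the maximum principle bounds by
  some value of \<open>u\<close> on each of the boundary levels \<open>l 1, \<dots>, l d\<close>.
\<close>

lemma exponential_decay:
  fixes l :: "nat \<Rightarrow> int"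
  assumes increasing: "\<And>i. i < d \<Longrightarrow> l i < l (Suc i)" and below: "\<And>i. i \<le> d \<Longrightarrow> l i < r"
    and boundary: "\<And>i. i \<in> {1..d} \<Longrightarrow> \<exists>x\<in>vertex_boundary (line_product \<Gamma>) A. fst x = l i"
    and v: "0 \<le> v" "v \<le> 1"
    and dominated: "\<And>i. i \<in> {1..d} \<Longrightarrow> \<exists>x\<in>slice (l i). v \<le> u x"
  shows "v \<le> 5 * exp (- (1 / (4 ^ 4 * width ^ 3)) * (real d ^ 2 * \<epsilon>) powr (1 / 3))"
proof (rule cube_root_exponential_bound[OF width_ge_1 rate v])
  assume k: "0 < d div 3"
  show "v\<^sup>2 * (1 + 2 * sqrt \<epsilon> / width) ^ (d div 3) \<le> 2 * width\<^sup>2 / (\<epsilon> * (real (d div 3))\<^sup>2)"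
  proof (rule three_stage_decay[where g = "\<lambda>i. flux_in (l i)" and e = "\<lambda>i. slice_energy (l (Suc i))",
        OF width_ge_1 rate(1) k])
    show "0 \<le> flux_in (l 0)" by (intro flux_in_nonneg below) simp
    show "flux_in (l i) \<le> width" for i by (rule flux_in_le_width)
    show "0 \<le> slice_energy (l (Suc i))" for i by (rule slice_energy_nonneg)
    fix i assume "i < 3 * (d div 3)"
    then have i: "i < d" "Suc i \<in> {1..d}" by auto
    have lt: "l (Suc i) < r" using below i by simp
    have le: "flux_in (l i) \<le> flux_in (l (Suc i) - 1)"
      using increasing[OF i(1)] lt by (intro flux_in_mono) auto
    have nonneg: "0 \<le> flux_in (l i)" using below i by (intro flux_in_nonneg) simp
    obtain b where b: "b \<in> vertex_boundary (line_product \<Gamma>) A" "fst b = l (Suc i)"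
      using boundary i(2) by blast
    show "flux_in (l i) + slice_energy (l (Suc i)) \<le> flux_in (l (Suc i))"
      using le energy_balance[OF lt] flux_in_eq[of "l (Suc i)"] crossing_energy_nonneg[of "l (Suc i)"]
      by linarith
    have "(1 + 2 * sqrt \<epsilon> / width) * flux_in (l i) \<le> (1 + 2 * sqrt \<epsilon> / width) * flux_in (l (Suc i) - 1)"
      using le rate by (intro mult_left_mono) auto
    also have "\<dots> \<le> flux_in (l (Suc i))" by (rule flux_in_geometric_growth[OF lt b])
    finally show "(1 + 2 * sqrt \<epsilon> / width) * flux_in (l i) \<le> flux_in (l (Suc i))" .
    have "(flux_in (l i))\<^sup>2 / width \<le> (flux_in (l (Suc i) - 1))\<^sup>2 / width"
      using le nonneg by (intro divide_right_mono power_mono) auto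
    then show "flux_in (l i) + (flux_in (l i))\<^sup>2 / width \<le> flux_in (l (Suc i))"
      using flux_in_quadratic_growth[OF lt] le by linarith
    obtain x where x: "x \<in> slice (l (Suc i))" "v \<le> u x" using dominated i(2) by blast
    have "v\<^sup>2 \<le> (u x)\<^sup>2" using x v by (intro power_mono)
    also have "\<dots> \<le> width / \<epsilon> * slice_energy (l (Suc i))"
      by (rule u_squared_le_slice_energy[OF x(1) b])
    finally show "v\<^sup>2 \<le> width / \<epsilon> * slice_energy (l (Suc i))" .
  qed
qed

end

section \<open>Hitting a set before crossing forbidden arcs\<close>

text \<open>
  From time \<open>k\<close> on, the trajectory \<open>X\<close> reaches \<open>T\<close> in at most \<open>n\<close> further steps without a step in \<open>B\<close>.
  The recursion unfolds the first of these steps, just as the recursion for \<open>hit_prob\<close> does.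
\<close>

fun hits_by :: "'a set \<Rightarrow> ('a \<times> 'a) set \<Rightarrow> (nat \<Rightarrow> 'a) \<Rightarrow> nat \<Rightarrow> nat \<Rightarrow> bool" where
  "hits_by T B X k 0 \<longleftrightarrow> X k \<in> T"
| "hits_by T B X k (Suc n) \<longleftrightarrow> X k \<in> T \<or> (X k, X (Suc k)) \<notin> B \<and> hits_by T B X (Suc k) n"

lemma hits_by_mono: "hits_by T B X k n \<Longrightarrow> hits_by T B X k (Suc n)"
  by (induction n arbitrary: k) auto

lemma hits_byI:
  assumes "X (k + n) \<in> T" "\<And>i. i < n \<Longrightarrow> (X (k + i), X (Suc (k + i))) \<notin> B"
  shows "hits_by T B X k n"
  using assms
proof (induction n arbitrary: k)
  case (Suc n)
  have "hits_by T B X (Suc k) n"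
    using Suc.prems(1) Suc.prems(2)[of "Suc _"] by (intro Suc.IH) auto
  then show ?case using Suc.prems(2)[of 0] by simp
qed simp

primrec hit_prob ::
    "'a pair_pre_digraph \<Rightarrow> ('a \<times> 'a \<Rightarrow> real) \<Rightarrow> 'a set \<Rightarrow> ('a \<times> 'a) set \<Rightarrow> nat \<Rightarrow> 'a \<Rightarrow> real"
where
  "hit_prob G c T B 0 x = of_bool (x \<in> T)"
| "hit_prob G c T B (Suc n) x =
     (if x \<in> T then 1
      else \<Sum>y | (x, y) \<in> parcs G - B. transition_prob G c x y * hit_prob G c T B n y)"

context random_walk
begin

lemma pred_walk [measurable]: "Measurable.pred M (\<lambda>\<omega>. P (S n \<omega>))"
proof -
  have "{\<omega> \<in> space M. P (S n \<omega>)} = S n -` {x \<in> pverts G. P x} \<inter> space M"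
    using measurable_space[OF measurable_walk] by (auto simp: space_count_space)
  also have "\<dots> \<in> sets M" by (rule measurable_sets[OF measurable_walk]) auto
  finally show ?thesis by (simp add: pred_def)
qed

lemma pred_hits_by:
  assumes "finite B"
  shows "Measurable.pred M (\<lambda>\<omega>. hits_by T B (\<lambda>i. S i \<omega>) k n)"
proof (induction n arbitrary: k)
  case 0
  then show ?case by simp
next
  case (Suc n)
  note Suc [measurable] assms [measurable]
  have eq: "(\<lambda>\<omega>. (S k \<omega>, S (Suc k) \<omega>) \<notin> B) =
      (\<lambda>\<omega>. \<forall>p\<in>B. \<not> (S k \<omega> = fst p \<and> S (Suc k) \<omega> = snd p))"
    by force
  have [measurable]: "Measurable.pred M (\<lambda>\<omega>. (S k \<omega>, S (Suc k) \<omega>) \<notin> B)"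
    unfolding eq by (intro pred_intros_finite assms) measurable
  show ?case by simp
qed

text \<open>
  The Markov property is available for cylinder events only, so the induction over the number of further
  steps carries an arbitrary history \<open>x\<close> up to time \<open>k\<close> and extends it by the next position. This is a
  finite case distinction, because \<open>x k\<close> has finitely many out-neighbours.
\<close>

lemma prob_hits_by_after_history:
  assumes out: "\<And>x. x \<in> pverts G \<Longrightarrow>
      finite {y. (x, y) \<in> parcs G} \<and> (\<Sum>y | (x, y) \<in> parcs G. c (x, y)) \<noteq> 0"
    and B: "finite B"
  shows "\<P>(\<omega> in M. (\<forall>i\<le>k. S i \<omega> = x i) \<and> hits_by T B (\<lambda>i. S i \<omega>) k n)
    \<le> \<P>(\<omega> in M. \<forall>i\<le>k. S i \<omega> = x i) * hit_prob G c T B n (x k)"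
proof (induction n arbitrary: k x)
  case 0
  show ?case
  proof (cases "x k \<in> T")
    case True
    have "prob {\<omega> \<in> space M. (\<forall>i\<le>k. S i \<omega> = x i) \<and> hits_by T B (\<lambda>i. S i \<omega>) k 0}
        \<le> prob {\<omega> \<in> space M. \<forall>i\<le>k. S i \<omega> = x i}"
      by (rule finite_measure_mono) auto
    then show ?thesis using True by simp
  next
    case False
    then have "{\<omega> \<in> space M. (\<forall>i\<le>k. S i \<omega> = x i) \<and> hits_by T B (\<lambda>i. S i \<omega>) k 0} = {}" by auto
    then show ?thesis using False by (simp only: measure_empty) simp
  qed
next
  case (Suc n)
  note pred_hits_by[OF B, measurable]
  define C where "C = {\<omega> \<in> space M. \<forall>i\<le>k. S i \<omega> = x i}"
  have C [measurable]: "C \<in> sets M" unfolding C_def by measurable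
  let ?E = "{\<omega> \<in> space M. (\<forall>i\<le>k. S i \<omega> = x i) \<and> hits_by T B (\<lambda>i. S i \<omega>) k (Suc n)}"
  have E_C: "prob ?E \<le> prob C"
    by (rule finite_measure_mono) (auto simp: C_def)
  consider "x k \<in> T" | "prob C = 0" | "x k \<notin> T" "prob C \<noteq> 0" by blast
  then show ?case
  proof cases
    case 1
    then show ?thesis using E_C by (simp add: C_def)
  next
    case 2
    then show ?thesis using E_C by (simp add: C_def)
  next
    case 3
    from 3(2) have "C \<noteq> {}" by auto
    then have xk: "x k \<in> pverts G"
      using measurable_space[OF measurable_walk, of _ k] by (fastforce simp: C_def space_count_space)
    define N where "N = {y. (x k, y) \<in> parcs G}"
    have N: "finite N" "(\<Sum>y\<in>N. c (x k, y)) \<noteq> 0" using out[OF xk] by (auto simp: N_def)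
    define H where "H y = {\<omega> \<in> space M. \<forall>i\<le>Suc k. S i \<omega> = (x(Suc k := y)) i}" for y
    have H [measurable]: "H y \<in> sets M" for y unfolding H_def by measurable
    have H_eq: "H y = {\<omega> \<in> space M. S (Suc k) \<omega> = y \<and> (\<forall>i\<le>k. S i \<omega> = x i)}" for y
      by (auto simp: H_def le_Suc_eq)
    have prob_H: "prob (H y) = prob C * transition_prob G c (x k) y" for y
      using markov[of k x y] 3(2) by (simp add: cond_prob_def H_eq C_def field_simps)
    have total: "(\<Sum>y\<in>N. transition_prob G c (x k) y) = 1"
      using N(2) by (simp add: transition_prob_def N_def flip: sum_divide_distrib)
    have disj: "disjoint_family_on H N" by (auto simp: disjoint_family_on_def H_eq)
    have UH: "(\<Union>y\<in>N. H y) \<subseteq> C" by (auto simp: C_def H_eq)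
    have "prob (\<Union>y\<in>N. H y) = prob C"
      using finite_measure_finite_Union[OF N(1) _ disj] total
      by (simp add: prob_H image_subset_iff flip: sum_distrib_left)
    \<comment> \<open>Given the history, the next position is almost surely an out-neighbour.\<close>
    then have null: "prob (C - (\<Union>y\<in>N. H y)) = 0"
      using finite_measure_Diff[OF C _ UH] N(1) by (simp add: sets.finite_UN)
    define N' where "N' = {y. (x k, y) \<in> parcs G - B}"
    have N': "finite N'" using N(1) by (rule finite_subset[rotated]) (auto simp: N_def N'_def)
    define F where "F y = {\<omega> \<in> space M. (\<forall>i\<le>Suc k. S i \<omega> = (x(Suc k := y)) i) \<and>
        hits_by T B (\<lambda>i. S i \<omega>) (Suc k) n}" for y
    have F [measurable]: "F y \<in> sets M" for y unfolding F_def by measurable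
    have [measurable]: "(\<Union>y\<in>N. H y) \<in> sets M" "(\<Union>y\<in>N'. F y) \<in> sets M"
      using N(1) N' by (auto intro!: sets.finite_UN)
    have "?E \<subseteq> (C - (\<Union>y\<in>N. H y)) \<union> (\<Union>y\<in>N'. F y)"
      using 3(1) by (auto simp: C_def H_eq F_def N_def N'_def le_Suc_eq)
    then have "prob ?E \<le> prob ((C - (\<Union>y\<in>N. H y)) \<union> (\<Union>y\<in>N'. F y))"
      by (rule finite_measure_mono) measurable
    also have "\<dots> \<le> prob (C - (\<Union>y\<in>N. H y)) + prob (\<Union>y\<in>N'. F y)"
      by (rule measure_Un_le) measurable
    also have "\<dots> \<le> (\<Sum>y\<in>N'. prob (F y))"
      using null finite_measure_subadditive_finite[OF N', of F] by (simp add: image_subset_iff)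
    also have "\<dots> \<le> (\<Sum>y\<in>N'. prob (H y) * hit_prob G c T B n y)"
      using Suc.IH[of "Suc k" "x(Suc k := _)"] by (intro sum_mono) (simp add: F_def H_def)
    also have "\<dots> = prob C * hit_prob G c T B (Suc n) (x k)"
      using 3(1) by (simp add: prob_H N'_def sum_distrib_left mult.assoc)
    finally show ?thesis by (simp add: C_def)
  qed
qed

lemma prob_hits_before_le:
  assumes out: "\<And>x. x \<in> pverts G \<Longrightarrow>
      finite {y. (x, y) \<in> parcs G} \<and> (\<Sum>y | (x, y) \<in> parcs G. c (x, y)) \<noteq> 0"
    and B: "finite B" and le: "\<And>n. hit_prob G c T B n a \<le> q"
  shows "\<P>(\<omega> in M. \<exists>n. S n \<omega> \<in> T \<and> (\<forall>i<n. (S i \<omega>, S (Suc i) \<omega>) \<notin> B)) \<le> q"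
proof -
  note pred_hits_by[OF B, measurable]
  define F where "F n = {\<omega> \<in> space M. hits_by T B (\<lambda>i. S i \<omega>) 0 n}" for n
  have F [measurable]: "F n \<in> sets M" for n unfolding F_def by measurable
  have F_le: "prob (F n) \<le> q" for n
  proof -
    have "prob (F n) = \<P>(\<omega> in M. (\<forall>i\<le>0. S i \<omega> = a) \<and> hits_by T B (\<lambda>i. S i \<omega>) 0 n)"
      unfolding F_def by (rule finite_measure_eq_AE) (use start in auto)
    also have "\<dots> \<le> \<P>(\<omega> in M. \<forall>i\<le>0. S i \<omega> = a) * hit_prob G c T B n a"
      using prob_hits_by_after_history[OF out B, of 0 "\<lambda>_. a" T n] by simp
    also have "\<P>(\<omega> in M. \<forall>i\<le>0. S i \<omega> = a) = 1"
      using start by (intro prob_Collect_eq_1[THEN iffD2]) auto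
    finally show ?thesis using le[of n] by simp
  qed
  have "prob {\<omega> \<in> space M. \<exists>n. S n \<omega> \<in> T \<and> (\<forall>i<n. (S i \<omega>, S (Suc i) \<omega>) \<notin> B)}
      \<le> prob (\<Union>n. F n)"
    by (rule finite_measure_mono) (auto simp: F_def intro!: hits_byI)
  also have "\<dots> \<le> q"
  proof (rule LIMSEQ_le_const2)
    show "(\<lambda>n. prob (F n)) \<longlonglongrightarrow> prob (\<Union>n. F n)"
      by (intro finite_Lim_measure_incseq)
         (auto simp: F_def intro!: incseq_SucI intro: hits_by_mono simp del: hits_by.simps)
  qed (use F_le in auto)
  finally show ?thesis .
qed

end

section \<open>The reinforced walk up to its exit from the subgraph\<close>

context line_subgraph
begin

definition hit_before_exit :: "real \<Rightarrow> int \<Rightarrow> nat \<Rightarrow> int \<times> 'v \<Rightarrow> real" where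
  "hit_before_exit \<delta> r = hit_prob (line_product \<Gamma>) (reinforced_conductance \<delta> A)
     {x. fst x = r} (edge_boundary (line_product \<Gamma>) A)"

text \<open>
  The total conductance at \<open>x\<close> in the network with unit conductances on \<open>A\<close> and \<open>\<epsilon>\<close> on the boundary arcs.
  For \<open>\<epsilon> = 1 / (1 + \<delta>)\<close> this is the reinforced network, rescaled by \<open>1 + \<delta>\<close>.
\<close>

definition killed_degree :: "real \<Rightarrow> int \<times> 'v \<Rightarrow> real" where
  "killed_degree \<epsilon> x = real (card {y. (x, y) \<in> E}) + \<epsilon> * real (card (exits x))"

lemma finite_edge_boundary: "finite (edge_boundary (line_product \<Gamma>) A)"
proof (rule finite_subset)
  show "edge_boundary (line_product \<Gamma>) A \<subseteq> (SIGMA x:V. exits x)"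
    by (auto simp: edge_boundary_def exits_def)
qed (auto intro!: finite_SigmaI)

lemma total_conductance_nonzero:
  assumes "x \<in> pverts (line_product \<Gamma>)" "0 < \<delta>"
  shows "(\<Sum>y | (x, y) \<in> parcs (line_product \<Gamma>). reinforced_conductance \<delta> A (x, y)) \<noteq> 0"
proof -
  have "(fst x + 1, snd x) \<in> {y. (x, y) \<in> parcs (line_product \<Gamma>)}"
    using assms(1) by (auto simp: line_product_def)
  then have "0 < (\<Sum>y | (x, y) \<in> parcs (line_product \<Gamma>). reinforced_conductance \<delta> A (x, y))"
    using assms(2) finite_neighbours
    by (intro sum_pos) (auto simp: reinforced_conductance_def add_pos_nonneg)
  then show ?thesis by simp
qed

lemma total_conductance:
  assumes "x \<in> V" "0 < \<delta>"
  shows "(\<Sum>y | (x, y) \<in> parcs (line_product \<Gamma>). reinforced_conductance \<delta> A (x, y)) =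
    (1 + \<delta>) * killed_degree (1 / (1 + \<delta>)) x"
proof -
  have "(\<Sum>y | (x, y) \<in> parcs (line_product \<Gamma>). reinforced_conductance \<delta> A (x, y)) =
      (\<Sum>y | (x, y) \<in> E. reinforced_conductance \<delta> A (x, y)) +
      (\<Sum>y\<in>exits x. reinforced_conductance \<delta> A (x, y))"
    unfolding neighbours_split[OF assms(1)]
    by (intro sum.union_disjoint finite_arcs_from finite_exits)
      (auto simp: exits_def edge_boundary_def)
  also have "(\<Sum>y | (x, y) \<in> E. reinforced_conductance \<delta> A (x, y)) = (\<Sum>y | (x, y) \<in> E. 1 + \<delta>)"
    by (intro sum.cong) (auto simp: reinforced_conductance_def)
  also have "(\<Sum>y\<in>exits x. reinforced_conductance \<delta> A (x, y)) = (\<Sum>y\<in>exits x. 1)"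
    by (intro sum.cong) (auto simp: reinforced_conductance_def exits_def edge_boundary_def)
  finally show ?thesis using assms(2) by (simp add: killed_degree_def distrib_left) (simp add: algebra_simps)
qed

context
  fixes \<delta> :: real and r :: int
  assumes \<delta>: "0 < \<delta>"
begin

lemma killed_degree_pos: "0 < killed_degree (1 / (1 + \<delta>)) x" if "x \<in> V"
proof -
  have "x \<in> pverts (line_product \<Gamma>)"
    using that V_subset by (cases x) (auto simp: line_product_def)
  then have "killed_degree (1 / (1 + \<delta>)) x \<noteq> 0"
    using total_conductance_nonzero[of x \<delta>] total_conductance[OF that \<delta>] \<delta> by auto
  moreover have "0 \<le> killed_degree (1 / (1 + \<delta>)) x" using \<delta> by (simp add: killed_degree_def)
  ultimately show ?thesis by simp
qed

lemma hit_before_exit_simps: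
  assumes "x \<in> V"
  shows "hit_before_exit \<delta> r 0 x = of_bool (fst x = r)"
    and "hit_before_exit \<delta> r (Suc n) x = (if fst x = r then 1 else
      (\<Sum>y | (x, y) \<in> E. hit_before_exit \<delta> r n y) / killed_degree (1 / (1 + \<delta>)) x)"
proof -
  have arcs: "{y. (x, y) \<in> parcs (line_product \<Gamma>) - edge_boundary (line_product \<Gamma>) A} = {y. (x, y) \<in> E}"
    using assms E_subset by (auto simp: edge_boundary_def)
  have "transition_prob (line_product \<Gamma>) (reinforced_conductance \<delta> A) x y =
      1 / killed_degree (1 / (1 + \<delta>)) x" if "(x, y) \<in> E" for y
    using that E_subset \<delta> total_conductance[OF assms \<delta>]
    by (auto simp: transition_prob_def reinforced_conductance_def)
  then have "(\<Sum>y | (x, y) \<in> E. transition_prob (line_product \<Gamma>) (reinforced_conductance \<delta> A) x y *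
        hit_before_exit \<delta> r n y) =
      (\<Sum>y | (x, y) \<in> E. hit_before_exit \<delta> r n y / killed_degree (1 / (1 + \<delta>)) x)"
    by (intro sum.cong) auto
  then show "hit_before_exit \<delta> r (Suc n) x = (if fst x = r then 1 else
      (\<Sum>y | (x, y) \<in> E. hit_before_exit \<delta> r n y) / killed_degree (1 / (1 + \<delta>)) x)"
    by (simp only: hit_before_exit_def hit_prob.simps arcs sum_divide_distrib mem_Collect_eq)
qed (simp add: hit_before_exit_def)

lemma average_le:
  assumes "x \<in> V" "0 \<le> q" "\<And>y. (x, y) \<in> E \<Longrightarrow> f y \<le> q"
  shows "(\<Sum>y | (x, y) \<in> E. f y) / killed_degree (1 / (1 + \<delta>)) x \<le> q"
proof -
  have "(\<Sum>y | (x, y) \<in> E. f y) \<le> real (card {y. (x, y) \<in> E}) * q"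
    using sum_bounded_above[of "{y. (x, y) \<in> E}" f q] assms(3) by simp
  also have "\<dots> \<le> killed_degree (1 / (1 + \<delta>)) x * q"
    using assms(2) \<delta> by (intro mult_right_mono) (auto simp: killed_degree_def)
  finally show ?thesis using killed_degree_pos[OF assms(1)] by (simp add: pos_divide_le_eq mult.commute)
qed

lemma hit_before_exit_bounds:
  assumes "x \<in> V"
  shows "0 \<le> hit_before_exit \<delta> r n x \<and> hit_before_exit \<delta> r n x \<le> 1"
  using assms
proof (induction n arbitrary: x)
  case (Suc n)
  have "0 \<le> hit_before_exit \<delta> r n y" "hit_before_exit \<delta> r n y \<le> 1" if "(x, y) \<in> E" for y
    using Suc.IH A.in_arcsD2[OF that] by auto
  then have "0 \<le> (\<Sum>y | (x, y) \<in> E. hit_before_exit \<delta> r n y) / killed_degree (1 / (1 + \<delta>)) x"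
    "(\<Sum>y | (x, y) \<in> E. hit_before_exit \<delta> r n y) / killed_degree (1 / (1 + \<delta>)) x \<le> 1"
    using killed_degree_pos[OF Suc.prems] Suc.prems
    by (auto intro!: divide_nonneg_pos sum_nonneg average_le simp del: divide_le_eq_1_pos)
  then show ?case
    by (simp only: hit_before_exit_simps(2)[OF Suc.prems]) simp
qed (simp add: hit_before_exit_simps)

lemma hit_before_exit_mono:
  assumes "x \<in> V"
  shows "hit_before_exit \<delta> r n x \<le> hit_before_exit \<delta> r (Suc n) x"
  using assms
proof (induction n arbitrary: x)
  case 0
  then show ?case
    using hit_before_exit_bounds[of x "Suc 0"]
    by (cases "fst x = r") (simp_all add: hit_before_exit_simps(1) hit_before_exit_simps(2)[of x 0])
next
  case (Suc n)
  have "(\<Sum>y | (x, y) \<in> E. hit_before_exit \<delta> r n y) \<le> (\<Sum>y | (x, y) \<in> E. hit_before_exit \<delta> r (Suc n) y)"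
    using Suc.IH A.in_arcsD2 by (intro sum_mono) blast
  then show ?case
    using Suc.prems killed_degree_pos[OF Suc.prems]
    by (simp add: hit_before_exit_simps(2)[OF Suc.prems] divide_right_mono)
qed

text \<open>
  A maximum principle: the walk moves by at most one level per step, so from a vertex at or below level \<open>s\<close> it
  reaches level \<open>r\<close> only through level \<open>s\<close>.
\<close>

lemma hit_before_exit_le_slice:
  assumes "s < r" "0 \<le> q" and q: "\<And>y. y \<in> slice s \<Longrightarrow> hit_before_exit \<delta> r N y \<le> q"
    and "n \<le> N" "x \<in> V" "fst x \<le> s"
  shows "hit_before_exit \<delta> r n x \<le> q"
  using assms(4-)
proof (induction n arbitrary: x)
  case 0
  then show ?case using assms(1,2) by (simp add: hit_before_exit_simps)
next
  case (Suc n)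
  show ?case
  proof (cases "fst x = s")
    case True
    have "hit_before_exit \<delta> r (Suc n) x \<le> hit_before_exit \<delta> r N x"
      using hit_before_exit_mono[OF Suc.prems(2)] Suc.prems(1)
      by (rule lift_Suc_mono_le[of "\<lambda>n. hit_before_exit \<delta> r n x"])
    also have "\<dots> \<le> q" using True Suc.prems by (intro q) (simp add: slice_def)
    finally show ?thesis .
  next
    case False
    have "hit_before_exit \<delta> r n y \<le> q" if "(x, y) \<in> E" for y
      using that Suc.prems False A.in_arcsD2 by (intro Suc.IH) (auto elim: arc_cases)
    then show ?thesis
      using Suc.prems False assms(1,2) by (auto simp: hit_before_exit_simps(2) intro!: average_le)
  qed
qed

text \<open>
  One more step can only help, so the function is at most its own average over the next step of the killed
  walk.
\<close>

lemma killed_subharmonic_hit_before_exit: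
  "killed_subharmonic \<Gamma> A (hit_before_exit \<delta> r n) (1 / (1 + \<delta>)) r"
proof
  fix x assume x: "x \<in> V" "fst x < r"
  let ?u = "hit_before_exit \<delta> r n" and ?\<epsilon> = "1 / (1 + \<delta>)"
  have "?u x \<le> (\<Sum>y | (x, y) \<in> E. ?u y) / killed_degree ?\<epsilon> x"
    using hit_before_exit_mono[OF x(1), of n] x by (simp add: hit_before_exit_simps)
  then have "?u x * killed_degree ?\<epsilon> x \<le> (\<Sum>y | (x, y) \<in> E. ?u y)"
    using killed_degree_pos[OF x(1)] by (simp add: pos_le_divide_eq)
  then show "(\<Sum>y | (x, y) \<in> E. ?u x - ?u y) + ?\<epsilon> * real (card (exits x)) * ?u x \<le> 0"
    by (simp add: sum_subtractf killed_degree_def algebra_simps)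
qed (use \<delta> hit_before_exit_bounds in auto)

lemma hit_before_exit_le_cube_root:
  fixes l :: "nat \<Rightarrow> int"
  assumes increasing: "\<And>i. i < d \<Longrightarrow> l i < l (Suc i)" and below: "\<And>i. i \<le> d \<Longrightarrow> l i < r"
    and boundary: "\<And>i. i \<in> {1..d} \<Longrightarrow> \<exists>x\<in>vertex_boundary (line_product \<Gamma>) A. fst x = l i"
    and a: "a \<in> V" "fst a = l 0"
  shows "hit_before_exit \<delta> r n a \<le>
    5 * exp (- (1 / (4 ^ 4 * width ^ 3)) * (real d ^ 2 * (1 / (1 + \<delta>))) powr (1 / 3))"
proof -
  interpret killed_subharmonic \<Gamma> A "hit_before_exit \<delta> r n" "1 / (1 + \<delta>)" r
    by (rule killed_subharmonic_hit_before_exit)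
  show ?thesis
  proof (rule exponential_decay[where l = l and d = d])
    fix i assume i: "i \<in> {1..d}"
    have "l 0 \<le> l i" using i
    proof (induction i rule: nat_induct)
      case (Suc i)
      then show ?case using increasing[of i] by (cases "i = 0") auto
    qed simp
    let ?u = "hit_before_exit \<delta> r n"
    define q where "q = Max (?u ` slice (l i))"
    have "slice (l i) \<noteq> {}"
      using boundary[OF i] by (auto simp: slice_def vertex_boundary_def)
    then have "q \<in> ?u ` slice (l i)" unfolding q_def by (intro Max_in) auto
    then obtain x where x: "x \<in> slice (l i)" "q = ?u x" by blast
    have "?u a \<le> q"
    proof (rule hit_before_exit_le_slice)
      show "l i < r" using below i by simp
      show "0 \<le> q" using x u_nonneg by (auto simp: slice_def)
      show "?u y \<le> q" if "y \<in> slice (l i)" for y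
        unfolding q_def using that by (intro Max_ge) auto
    qed (use a \<open>l 0 \<le> l i\<close> in auto)
    then show "\<exists>x\<in>slice (l i). ?u a \<le> ?u x" using x by auto
  qed (use a u_nonneg u_le_1 increasing below boundary in auto)
qed

end

end

lemma level_hitting_time_less_exit_time_iff:
  "level_hitting_time r S \<omega> < exit_time G A S \<omega> \<longleftrightarrow>
    (\<exists>n. S n \<omega> \<in> {x. fst x = r} \<and> (\<forall>i<n. (S i \<omega>, S (Suc i) \<omega>) \<notin> edge_boundary G A))"
    (is "?L \<longleftrightarrow> ?R")
proof
  assume ?L
  then obtain k where "k \<in> {enat n | n. fst (S n \<omega>) = r}" and less: "k < exit_time G A S \<omega>"
    unfolding level_hitting_time_def Inf_less_iff by blast
  then obtain n where n: "fst (S n \<omega>) = r" "k = enat n" by blast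
  have "(S i \<omega>, S (Suc i) \<omega>) \<notin> edge_boundary G A" if "i < n" for i
  proof
    assume "(S i \<omega>, S (Suc i) \<omega>) \<in> edge_boundary G A"
    then have "exit_time G A S \<omega> \<le> enat (Suc i)"
      unfolding exit_time_def by (intro Inf_lower) (auto intro!: exI[of _ "Suc i"])
    then show False using less n(2) that by (meson enat_ord_simps(1) leD less_le_trans Suc_leI)
  qed
  then show ?R using n by blast
next
  assume ?R
  then obtain n where n: "fst (S n \<omega>) = r"
    and stay: "\<And>i. i < n \<Longrightarrow> (S i \<omega>, S (Suc i) \<omega>) \<notin> edge_boundary G A" by blast
  have "level_hitting_time r S \<omega> \<le> enat n"
    unfolding level_hitting_time_def using n by (intro Inf_lower) auto
  also have "enat n < enat (Suc n)" by simp
  also have "\<dots> \<le> exit_time G A S \<omega>"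
    unfolding exit_time_def
  proof (rule Inf_greatest)
    fix k assume "k \<in> {enat n | n. n \<ge> 1 \<and> (S (n - 1) \<omega>, S n \<omega>) \<in> edge_boundary G A}"
    then obtain j where j: "k = enat j" "1 \<le> j" "(S (j - 1) \<omega>, S j \<omega>) \<in> edge_boundary G A" by blast
    then have "\<not> j - 1 < n" using stay[of "j - 1"] by auto
    then show "enat (Suc n) \<le> k" using j by simp
  qed
  finally show ?L .
qed

theorem proposition2p6:
  fixes \<Gamma> :: "'v pair_pre_digraph"
    and A :: "(int \<times> 'v) pair_pre_digraph"
    and a :: "int \<times> 'v"
    and \<delta> :: real
    and M :: "'w measure"
    and S :: "nat \<Rightarrow> 'w \<Rightarrow> int \<times> 'v"
    and d :: nat
    and s :: "nat \<Rightarrow> int"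
    and r :: int
  assumes "pair_graph \<Gamma>" and "Digraph_Component.connected (with_proj \<Gamma>)"
    and "pair_graph A" and "Digraph_Component.connected (with_proj A)"
    and "subgraph (with_proj A) (with_proj (line_product \<Gamma>))"
    and "\<delta> > 0"
    and "random_walk M (line_product \<Gamma>) (reinforced_conductance \<delta> A) a S"
    and "a \<in> pverts A"
    and "sorted_wrt (<) (fst a # map s [1..<Suc d] @ [r])"
    and "\<And>i. i \<in> {1..d} \<Longrightarrow> \<exists>x \<in> vertex_boundary (line_product \<Gamma>) A. fst x = s i"
  shows "\<P>(\<omega> in M. level_hitting_time r S \<omega> < exit_time (line_product \<Gamma>) A S \<omega>)
    \<le> 5 * exp (- (1 / (4 ^ 4 * real (card (pverts \<Gamma>)) ^ 3)) * (real d ^ 2 / (1 + \<delta>)) powr (1 / 3))"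
proof -
  interpret line_subgraph \<Gamma> A
    by (rule line_subgraph.intro) fact+
  interpret random_walk M "line_product \<Gamma>" "reinforced_conductance \<delta> A" a S by fact
  define l where "l i = (if i = 0 then fst a else s i)" for i
  have first: "\<And>i. i \<in> {1..d} \<Longrightarrow> fst a < s i" "fst a < r" and last: "\<And>i. i \<in> {1..d} \<Longrightarrow> s i < r"
    and sorted: "sorted_wrt (<) (map s [1..<Suc d])"
    using assms(9) by (auto simp: sorted_wrt_append simp del: upt_Suc)
  have between: "s i < s (Suc i)" if "1 \<le> i" "i < d" for i
    using sorted_wrt_nth_less[OF sorted, of "i - 1" i] that by (simp del: upt_Suc)
  show ?thesis
    unfolding level_hitting_time_less_exit_time_iff
  proof (rule prob_hits_before_le)
    fix x assume "x \<in> pverts (line_product \<Gamma>)"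
    then show "finite {y. (x, y) \<in> parcs (line_product \<Gamma>)} \<and>
        (\<Sum>y | (x, y) \<in> parcs (line_product \<Gamma>). reinforced_conductance \<delta> A (x, y)) \<noteq> 0"
      using finite_neighbours total_conductance_nonzero \<open>\<delta> > 0\<close> by blast
  next
    show "finite (edge_boundary (line_product \<Gamma>) A)" by (rule finite_edge_boundary)
  next
    fix n
    have "hit_before_exit \<delta> r n a \<le>
        5 * exp (- (1 / (4 ^ 4 * width ^ 3)) * (real d ^ 2 * (1 / (1 + \<delta>))) powr (1 / 3))"
    proof (rule hit_before_exit_le_cube_root[where l = l])
      show "l i < l (Suc i)" if "i < d" for i
        using that between[of i] first(1)[of "Suc i"] by (auto simp: l_def)
      show "l i < r" if "i \<le> d" for i using that first(2) last[of i] by (auto simp: l_def)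
      show "\<exists>x\<in>vertex_boundary (line_product \<Gamma>) A. fst x = l i" if "i \<in> {1..d}" for i
        using assms(10)[OF that] that by (auto simp: l_def)
    qed (use assms in \<open>auto simp: l_def\<close>)
    then show "hit_prob (line_product \<Gamma>) (reinforced_conductance \<delta> A) {x. fst x = r}
        (edge_boundary (line_product \<Gamma>) A) n a \<le>
        5 * exp (- (1 / (4 ^ 4 * width ^ 3)) * (real d ^ 2 / (1 + \<delta>)) powr (1 / 3))"
      by (simp add: hit_before_exit_def)
  qed
qed

end
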